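(* Let $\mu$ be a probability measure on $\mathbb{R}$ whose support is not included in $(-\infty,0)$, and let $\mu^{*n}$ denote its $n$-fold convolution power. Consider the condition (E) there exists $\alpha>0$ such that $\mu^{*n}((-\infty,0))\le e^{-\alpha n}$ for infinitely many $n\ge1$. Whether (E) holds is determined by the restrictions of the measures $\mu^{*n}$, $n\ge1$, to $[0,\infty)$. Moreover, if (E) holds, then $\mu\in\mathscr{C}$, i.e. every probability measure $\mu_1$ on $\mathbb{R}$ such that $\mu_1^{*n}$ and $\mu^{*n}$ coincide on the Borel subsets of $[0,\infty)$ for all $n\ge1$ satisfies $\mu_1=\mu$.
   Context: $\mathscr{C}$ denotes the set of probability measures $\mu$ on $\mathbb{R}$ with the property: if $\mu_1$ is a probability measure on $\mathbb{R}$ with $\mu_1^{*n}=\mu^{*n}$ on $[0,\infty)$ for all $n\ge 1$, then $\mu_1=\mu$. Note $\mu^{*n}((-\infty,0))=\mathbb{P}(S_n<0)$ where $(S_n)$ is a random walk with $S_0=0$ and step distribution $\mu$. *)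

theory Defs
  imports "HOL-Probability.Probability" "HOL-Probability.Convolution"
begin

definition real_prob :: "real measure \<Rightarrow> bool" where
  "real_prob M \<longleftrightarrow> prob_space M \<and> sets M = sets borel"

fun conv_pow :: "real measure \<Rightarrow> nat \<Rightarrow> real measure" where
  "conv_pow M 0 = return borel 0"
| "conv_pow M (Suc n) = convolution (conv_pow M n) M"

definition msupport :: "real measure \<Rightarrow> real set" where
  "msupport M = {x. \<forall>e>0. emeasure M (ball x e) > 0}"

definition cond_E :: "real measure \<Rightarrow> bool" where
  "cond_E M \<longleftrightarrow> (\<exists>\<alpha>>0. infinite {n::nat. n \<ge> 1 \<and>
       measure (conv_pow M n) {..<0} \<le> exp (- \<alpha> * real n)})"

definition agree_nonneg :: "real measure \<Rightarrow> real measure \<Rightarrow> bool" where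
  "agree_nonneg M N \<longleftrightarrow> (\<forall>n\<ge>1. \<forall>A\<in>sets borel. A \<subseteq> {0..} \<longrightarrow>
       measure (conv_pow M n) A = measure (conv_pow N n) A)"

definition classC :: "real measure \<Rightarrow> bool" where
  "classC M \<longleftrightarrow> (\<forall>M1. real_prob M1 \<and> agree_nonneg M1 M \<longrightarrow> M1 = M)"

end

theory Submission
  imports Defs "HOL-Complex_Analysis.Conformal_Mappings"
begin

text \<open>
  Let \<open>M\<close> and \<open>N\<close> have convolution powers that agree on \<open>[0, \<infinity>)\<close>, and let \<open>\<phi>\<close> and \<open>\<psi>\<close> be their
  characteristic functions. The \<open>n\<close>-th powers then give the same mass to \<open>(-\<infinity>, 0)\<close>, and
  \<open>\<phi>^n - \<psi>^n\<close> is bounded by twice that mass. Under (E) this makes \<open>(\<phi>/\<psi>)^n\<close> uniformly close to 1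
  near the origin for infinitely many \<open>n\<close>. A continuous logarithm of \<open>\<phi>/\<psi>\<close> vanishing at 0, multiplied
  by such an \<open>n\<close>, cannot leave the strip \<open>|Im| < \<pi>/2\<close>, so it is zero and \<open>\<phi> = \<psi>\<close> near the origin.
  Since \<open>M - N\<close> lives on \<open>(-\<infinity>, 0)\<close>, the function \<open>\<phi> - \<psi>\<close> is the boundary value of a function
  holomorphic in a half-plane; vanishing on an interval of the boundary, it vanishes identically.
\<close>

section \<open>Convolution powers and their characteristic functions\<close>

lemma real_prob_iff_real_distribution: "real_prob M \<longleftrightarrow> real_distribution M"
  by (simp add: real_prob_def real_distribution_def real_distribution_axioms_def)

lemma real_distribution_convolution:
  assumes "real_distribution M" "real_distribution N"
  shows "real_distribution (convolution M N)"
proof -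
  interpret M: real_distribution M by fact
  interpret N: real_distribution N by fact
  interpret P: pair_prob_space M N ..
  have "prob_space (convolution M N)"
    unfolding convolution_def by (rule P.prob_space_distr) measurable
  then show ?thesis
    by (simp add: real_distribution_def real_distribution_axioms_def)
qed

lemma real_distribution_conv_pow:
  assumes "real_distribution M"
  shows "real_distribution (conv_pow M n)"
proof (induction n)
  case 0
  show ?case
    by (simp add: real_distribution_def real_distribution_axioms_def prob_space_return)
next
  case (Suc n)
  then show ?case
    using assms by (simp add: real_distribution_convolution)
qed

lemma char_convolution:
  assumes "real_distribution M" "real_distribution N"
  shows "char (convolution M N) t = char M t * char N t"
proof -
  interpret M: real_distribution M by fact
  interpret N: real_distribution N by fact
  interpret P: pair_prob_space M N ..
  have int: "integrable (M \<Otimes>\<^sub>M N) (\<lambda>(x, y). iexp (t * (x + y)))"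
    by (rule P.P.integrable_const_bound[where B = 1]) (auto split: prod.split)
  have "char (convolution M N) t = (CLINT p|(M \<Otimes>\<^sub>M N). (\<lambda>(x, y). iexp (t * (x + y))) p)"
    unfolding char_def convolution_def by (subst integral_distr) (auto simp: case_prod_unfold)
  also have "\<dots> = (CLINT x|M. CLINT y|N. iexp (t * (x + y)))"
    using P.integral_fst'[OF int] by simp
  also have "\<dots> = (CLINT x|M. CLINT y|N. iexp (t * x) * iexp (t * y))"
    by (simp add: distrib_left exp_add)
  also have "\<dots> = char M t * char N t"
    by (simp add: char_def)
  finally show ?thesis .
qed

lemma char_conv_pow:
  assumes "real_distribution M"
  shows "char (conv_pow M n) t = char M t ^ n"
proof (induction n)
  case 0
  show ?case by (simp add: char_def integral_return)
next
  case (Suc n)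
  then show ?case
    using assms by (simp add: char_convolution real_distribution_conv_pow)
qed

text \<open>Lets the case n = 1 of \<open>agree_nonneg\<close> speak about the measures
  themselves.\<close>

lemma conv_pow_1:
  assumes "real_distribution M"
  shows "conv_pow M 1 = M"
proof (rule Levy_uniqueness)
  show "char (conv_pow M 1) = char M"
    using char_conv_pow[OF assms, of 1] by auto
qed (use assms real_distribution_conv_pow[OF assms, of 1] in auto)

section \<open>Integrals split at the origin\<close>

lemma measure_neg_eq:
  assumes "real_distribution P"
  shows "measure P {..<0} = 1 - measure P {0..}"
proof -
  interpret real_distribution P by fact
  have "{..<0} = space P - {0::real..}" by auto
  then show ?thesis
    using prob_compl[of "{0..}"] by simp
qed

text \<open>The contributions of the nonnegative half-line cancel. The bound \<open>B\<close> serves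
  integrability, so that each integral may be split at 0.\<close>

lemma integral_diff_eq_neg_part:
  fixes f :: "real \<Rightarrow> complex"
  assumes "real_distribution P" "real_distribution Q"
    and agree: "\<And>A. A \<in> sets borel \<Longrightarrow> A \<subseteq> {0..} \<Longrightarrow> measure P A = measure Q A"
    and f [measurable]: "f \<in> borel_measurable borel" and bnd: "\<And>x. norm (f x) \<le> B"
  shows "(\<integral>x. f x \<partial>P) - (\<integral>x. f x \<partial>Q) =
    (\<integral>x. indicator {..<0} x *\<^sub>R f x \<partial>P) - (\<integral>x. indicator {..<0} x *\<^sub>R f x \<partial>Q)"
proof -
  \<comment> \<open>The nonnegative part is written against a restricted measure, so that agreement
    on Borel sets becomes an equality of measures and covers every \<open>f\<close> at once.\<close>
  have split: "(\<integral>x. f x \<partial>R) =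
      (\<integral>x. indicator {..<0} x *\<^sub>R f x \<partial>R) + (\<integral>x. f x \<partial>density R (indicator {0..}))"
    if "real_distribution R" for R
  proof -
    interpret real_distribution R by fact
    have int: "integrable R f"
      by (rule integrable_const_bound[where B = B]) (auto simp: bnd)
    have "(\<integral>x. f x \<partial>R) = (\<integral>x. indicator {..<0} x *\<^sub>R f x + indicator {0..} x *\<^sub>R f x \<partial>R)"
      by (intro Bochner_Integration.integral_cong) (auto split: split_indicator)
    also have "\<dots> = (\<integral>x. indicator {..<0} x *\<^sub>R f x \<partial>R) + (\<integral>x. indicator {0..} x *\<^sub>R f x \<partial>R)"
      by (intro Bochner_Integration.integral_add integrable_mult_indicator int) auto
    also have "(\<integral>x. indicator {0..} x *\<^sub>R f x \<partial>R) = (\<integral>x. f x \<partial>density R (\<lambda>x. ennreal (indicator {0..} x)))"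
      by (subst integral_density) auto
    finally show ?thesis by (simp add: ennreal_indicator)
  qed
  interpret P: real_distribution P by fact
  interpret Q: real_distribution Q by fact
  have "density P (indicator {0..}) = density Q (indicator {0..})"
  proof (rule measure_eqI)
    fix A assume "A \<in> sets (density P (indicator {0..}))"
    then have [measurable]: "A \<in> sets borel" by simp
    have "emeasure P ({0..} \<inter> A) = emeasure Q ({0..} \<inter> A)"
      using agree[of "{0..} \<inter> A"]
      by (simp add: P.emeasure_eq_measure Q.emeasure_eq_measure)
    then show "emeasure (density P (indicator {0..})) A = emeasure (density Q (indicator {0..})) A"
      by (simp add: emeasure_density indicator_inter_arith[symmetric])
  qed simp
  then show ?thesis
    using split[OF assms(1)] split[OF assms(2)] by simp
qed

lemma norm_integral_neg_part_le:
  fixes f :: "real \<Rightarrow> complex"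
  assumes "real_distribution P" and "f \<in> borel_measurable borel" and bnd: "\<And>x. norm (f x) \<le> 1"
  shows "norm (\<integral>x. indicator {..<0} x *\<^sub>R f x \<partial>P) \<le> measure P {..<0}"
proof -
  interpret P: real_distribution P by fact
  have "norm (\<integral>x. indicator {..<0} x *\<^sub>R f x \<partial>P) \<le> (\<integral>x. indicator {..<0} x \<partial>P)"
    by (rule Bochner_Integration.integral_norm_bound_integral)
      (use assms in \<open>auto split: split_indicator intro!: P.integrable_const_bound[where B = 1]\<close>)
  then show ?thesis by simp
qed

section \<open>Laplace transform of the negative part\<close>

text \<open>
  The Laplace transform of the part of \<open>M\<close> on \<open>(-\<infinity>, 0)\<close>, with the sign of the exponent chosen
  so that it converges for \<open>Re z \<ge> 0\<close>.
\<close>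
definition laplace_neg :: "real measure \<Rightarrow> complex \<Rightarrow> complex" where
  "laplace_neg M z = (\<integral>x. indicator {..<0} x *\<^sub>R exp (z * of_real x) \<partial>M)"

lemma exp_neg_le_1:
  assumes "0 \<le> Re z"
  shows "norm (indicator {..<0} x *\<^sub>R exp (z * of_real x)) \<le> 1"
  using assms by (auto split: split_indicator simp: mult_nonneg_nonpos)

lemma continuous_on_laplace_neg:
  assumes "real_distribution M"
  shows "continuous_on {z. 0 \<le> Re z} (laplace_neg M)"
proof (rule continuous_on_sequentiallyI)
  interpret real_distribution M by fact
  fix u :: "nat \<Rightarrow> complex" and a
  assume u: "\<forall>n. u n \<in> {z. 0 \<le> Re z}" "u \<longlonglongrightarrow> a"
  show "(\<lambda>n. laplace_neg M (u n)) \<longlonglongrightarrow> laplace_neg M a"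
    unfolding laplace_neg_def
  proof (rule integral_dominated_convergence[where w = "\<lambda>_. 1"])
    show "AE x in M. (\<lambda>i. indicator {..<0} x *\<^sub>R exp (u i * of_real x)) \<longlonglongrightarrow>
        indicator {..<0} x *\<^sub>R exp (a * of_real x)"
      using u by (intro AE_I2 tendsto_intros)
    show "AE x in M. norm (indicator {..<0} x *\<^sub>R exp (u i * of_real x)) \<le> 1" for i
      using u exp_neg_le_1[of "u i"] by auto
  qed auto
qed

text \<open>Differentiation under the integral. No moments of \<open>M\<close> are assumed: for x <
  0 and Re w \<ge> r the exponential absorbs the factor x, which bounds the difference quotients
  uniformly in x.\<close>

lemma holomorphic_on_laplace_neg:
  assumes "real_distribution M"
  shows "laplace_neg M holomorphic_on {z. 0 < Re z}"
proof -
  interpret real_distribution M by fact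
  have int: "integrable M (\<lambda>x. indicator {..<0} x *\<^sub>R exp (z * of_real x))" if "0 \<le> Re z" for z
    by (rule integrable_const_bound[where B = 1]) (use exp_neg_le_1[OF that] in auto)
  have "\<exists>D. (laplace_neg M has_field_derivative D) (at z)" if z: "0 < Re z" for z
  proof -
    \<comment> \<open>With half of Re z as radius, z + h stays in the convex half-plane Re w \<ge>
      r, where the mean value inequality applies.\<close>
    define r where "r = Re z / 2"
    have r: "r > 0" using z by (simp add: r_def)
    define D where "D = (\<integral>x. indicator {..<0} x *\<^sub>R (of_real x * exp (z * of_real x)) \<partial>M)"
    define q where "q h x = indicator {..<0} x *\<^sub>R ((exp ((z + h) * of_real x) - exp (z * of_real x)) / h)"
      for h :: complex and x :: real
    have bound: "norm (q h x) \<le> 1 / r" if h: "h \<in> ball 0 r - {0}" for h x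
    proof (cases "x < 0")
      case True
      have "norm (exp ((z + h) * of_real x) - exp (z * of_real x)) \<le> 1 / r * norm (z + h - z)"
      proof (rule field_differentiable_bound[where S = "{w. r \<le> Re w}"
            and f' = "\<lambda>w. of_real x * exp (w * of_real x)"])
        show "convex {w. r \<le> Re w}" by (rule convex_halfspace_Re_ge)
        show "((\<lambda>w. exp (w * of_real x)) has_field_derivative of_real x * exp (w * of_real x))
            (at w within {w. r \<le> Re w})" for w :: complex
          by (auto intro!: derivative_eq_intros)
        show "norm (of_real x * exp (w * of_real x)) \<le> 1 / r" if "w \<in> {w. r \<le> Re w}" for w :: complex
        proof -
          have "norm (of_real x * exp (w * of_real x)) = - x * exp (Re w * x)"
            using True by (simp add: norm_mult)
          also have "\<dots> \<le> - x * exp (r * x)"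
            using that True by (intro mult_left_mono) auto
          also have "\<dots> \<le> 1 / r"
          proof -
            \<comment> \<open>The inequality u \<le> exp u at u = -r x.\<close>
            have "- (r * x) \<le> exp (- (r * x))"
              using exp_ge_add_one_self[of "- (r * x)"] by linarith
            then have "- (r * x) * exp (r * x) \<le> exp (- (r * x)) * exp (r * x)"
              by (intro mult_right_mono) auto
            also have "\<dots> = 1" by (simp flip: exp_add)
            finally show ?thesis using r by (simp add: field_simps)
          qed
          finally show ?thesis .
        qed
        have "\<bar>Re h\<bar> < r" using h abs_Re_le_cmod[of h] by auto
        then show "z + h \<in> {w. r \<le> Re w}" "z \<in> {w. r \<le> Re w}"
          using z by (auto simp: r_def)
      qed
      then show ?thesis
        using True h by (simp add: q_def norm_divide field_simps)
    qed (use r in \<open>simp add: q_def\<close>)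
    have quot: "(laplace_neg M (z + h) - laplace_neg M z) / h = (\<integral>x. q h x \<partial>M)"
      if h: "h \<in> ball 0 r - {0}" for h
    proof -
      have "\<bar>Re h\<bar> < r" using h abs_Re_le_cmod[of h] by auto
      then have "0 \<le> Re (z + h)" using z by (auto simp: r_def)
      note ints = int[OF this] int[OF less_imp_le[OF z]]
      have "(laplace_neg M (z + h) - laplace_neg M z) / h =
         (\<integral>x. (indicator {..<0} x *\<^sub>R exp ((z + h) * of_real x) - indicator {..<0} x *\<^sub>R exp (z * of_real x)) / h \<partial>M)"
        unfolding laplace_neg_def using ints by simp
      also have "\<dots> = (\<integral>x. q h x \<partial>M)"
        by (intro Bochner_Integration.integral_cong) (auto simp: q_def split: split_indicator)
      finally show ?thesis .
    qed
    \<comment> \<open>Restricting to the ball keeps every sequence where \<open>bound\<close> and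
      \<open>quot\<close> hold; as the ball is open, the limit is the full derivative.\<close>
    have "((\<lambda>h. (laplace_neg M (z + h) - laplace_neg M z) / h) \<longlongrightarrow> D) (at 0 within ball 0 r)"
      unfolding tendsto_at_iff_sequentially
    proof (intro allI impI)
      fix X :: "nat \<Rightarrow> complex"
      assume X: "\<forall>i. X i \<in> ball 0 r - {0}" "X \<longlonglongrightarrow> 0"
      have "(\<lambda>i. \<integral>x. q (X i) x \<partial>M) \<longlonglongrightarrow> D"
        unfolding D_def
      proof (rule integral_dominated_convergence[where w = "\<lambda>_. 1 / r"])
        show "AE x in M. (\<lambda>i. q (X i) x) \<longlonglongrightarrow> indicator {..<0} x *\<^sub>R (of_real x * exp (z * of_real x))"
        proof (rule AE_I2)
          fix x
          have "((\<lambda>w. exp (w * of_real x)) has_field_derivative of_real x * exp (z * of_real x)) (at z)"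
            by (auto intro!: derivative_eq_intros)
          then have "((\<lambda>h. (exp ((z + h) * of_real x) - exp (z * of_real x)) / h) \<longlongrightarrow>
              of_real x * exp (z * of_real x)) (at 0)"
            by (simp add: DERIV_def)
          then have "((\<lambda>h. (exp ((z + h) * of_real x) - exp (z * of_real x)) / h) \<circ> X) \<longlonglongrightarrow>
              of_real x * exp (z * of_real x)"
            using X unfolding tendsto_at_iff_sequentially by auto
          then show "(\<lambda>i. q (X i) x) \<longlonglongrightarrow> indicator {..<0} x *\<^sub>R (of_real x * exp (z * of_real x))"
            unfolding q_def by (intro tendsto_scaleR tendsto_const) (simp add: o_def)
        qed
        show "AE x in M. norm (q (X i) x) \<le> 1 / r" for i
          using X bound by blast
      qed (auto simp: q_def)
      then show "((\<lambda>h. (laplace_neg M (z + h) - laplace_neg M z) / h) \<circ> X) \<longlonglongrightarrow> D"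
        using X quot by (simp add: o_def)
    qed
    then have "(laplace_neg M has_field_derivative D) (at z)"
      using r by (simp add: DERIV_def at_within_open[of 0 "ball 0 r"])
    then show ?thesis ..
  qed
  then show ?thesis
    by (auto simp: holomorphic_on_open open_halfspace_Re_gt)
qed

section \<open>Uniqueness from boundary values on an interval\<close>

lemma half_plane_uniqueness:
  fixes f :: "complex \<Rightarrow> complex"
  assumes hol: "f holomorphic_on {z. 0 < Re z}" and cont: "continuous_on {z. 0 \<le> Re z} f"
    and "0 < \<delta>" and zero: "\<And>t. \<bar>t\<bar> < \<delta> \<Longrightarrow> f (\<i> * of_real t) = 0" and z: "0 \<le> Re z"
  shows "f z = 0"
proof -
  \<comment> \<open>Extending \<open>f\<close> by 0 across the interval on the axis is holomorphic, by Morera's theorem.\<close>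
  define S where "S = ball 0 \<delta> \<union> {z::complex. 0 < Re z}"
  define g where "g z = (if 0 \<le> Re z then f z else 0)" for z
  have S: "open S" by (auto simp: S_def open_halfspace_Re_gt)
  have "of_real (\<delta> / 2) \<in> ball (0::complex) \<delta> \<inter> {z. 0 < Re z}"
    using \<open>0 < \<delta>\<close> by simp
  then have "connected S"
    unfolding S_def
    by (intro connected_Un convex_connected convex_halfspace_Re_gt convex_ball) blast
  \<comment> \<open>\<open>S\<close> meets the imaginary axis only inside the ball, so the two
    branches of \<open>g\<close> match where they meet.\<close>
  have axis: "f w = 0" if "w \<in> S" "Re w = 0" for w
  proof -
    have "w = \<i> * of_real (Im w)" using that by (simp add: complex_eq_iff)
    moreover have "\<bar>Im w\<bar> < \<delta>"
      using that abs_Im_le_cmod[of w] by (auto simp: S_def)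
    ultimately show ?thesis using zero by metis
  qed
  have "g holomorphic_on S"
  \<comment> \<open>The inner product of 1 with z is Re z, so the pasting line is the imaginary
    axis.\<close>
  proof (rule holomorphic_on_paste_across_line[OF S, where d = 1 and k = 0])
    have "(\<lambda>_. 0) holomorphic_on (S \<inter> {z. 1 \<bullet> z < 0})" by simp
    then show "g holomorphic_on (S \<inter> {z. 1 \<bullet> z < 0})"
      by (rule holomorphic_transform) (auto simp: g_def inner_complex_def)
    have "f holomorphic_on (S \<inter> {z. 0 < 1 \<bullet> z})"
      by (rule holomorphic_on_subset[OF hol]) (auto simp: inner_complex_def)
    then show "g holomorphic_on (S \<inter> {z. 0 < 1 \<bullet> z})"
      by (rule holomorphic_transform) (auto simp: g_def inner_complex_def)
    have eq: "S = (S \<inter> {z. 0 \<le> Re z}) \<union> (S \<inter> {z. Re z \<le> 0})" by auto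
    have "continuous_on ((S \<inter> {z. 0 \<le> Re z}) \<union> (S \<inter> {z. Re z \<le> 0})) g"
      unfolding g_def
    proof (rule continuous_on_cases_local)
      show "closedin (top_of_set ((S \<inter> {z. 0 \<le> Re z}) \<union> (S \<inter> {z. Re z \<le> 0}))) (S \<inter> {z. 0 \<le> Re z})"
        "closedin (top_of_set ((S \<inter> {z. 0 \<le> Re z}) \<union> (S \<inter> {z. Re z \<le> 0}))) (S \<inter> {z. Re z \<le> 0})"
        unfolding eq[symmetric]
        by (auto intro!: closedin_closed_Int closed_halfspace_Re_ge closed_halfspace_Re_le)
      show "continuous_on (S \<inter> {z. 0 \<le> Re z}) f"
        by (rule continuous_on_subset[OF cont]) auto
    qed (use axis in \<open>auto intro: antisym\<close>)
    then show "continuous_on S g" using eq by simp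
  qed simp
  have pos: "f w = 0" if "0 < Re w" for w
  proof -
    \<comment> \<open>On this left half-disc \<open>g\<close> is 0 by construction; the identity
      theorem spreads this over the connected set \<open>S\<close>.\<close>
    define V where "V = ball (0::complex) \<delta> \<inter> {z. Re z < 0}"
    have "of_real (- \<delta> / 2) \<in> V"
      using \<open>0 < \<delta>\<close> by (simp add: V_def)
    then have "V \<noteq> {}" by blast
    moreover have "open V" by (auto simp: V_def open_halfspace_Re_lt)
    moreover have "V \<subseteq> S" by (auto simp: V_def S_def)
    moreover have "w \<in> S" using that by (simp add: S_def)
    ultimately have "g w = 0"
      using analytic_continuation_open[of V S g "\<lambda>_. 0" w] S \<open>connected S\<close> \<open>g holomorphic_on S\<close>
      by (auto simp: g_def V_def)
    then show ?thesis using that by (simp add: g_def)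
  qed
  \<comment> \<open>Boundary points are reached from the right by continuity.\<close>
  have "(\<lambda>n. f (z + of_real (inverse (real (Suc n))))) \<longlonglongrightarrow> f z"
  proof (rule continuous_on_tendsto_compose[OF cont])
    have "(\<lambda>n. z + of_real (inverse (real (Suc n)))) \<longlonglongrightarrow> z + of_real 0"
      by (intro tendsto_intros LIMSEQ_inverse_real_of_nat)
    then show "(\<lambda>n. z + of_real (inverse (real (Suc n)))) \<longlonglongrightarrow> z" by simp
  qed (use z in auto)
  moreover have "f (z + of_real (inverse (real (Suc n)))) = 0" for n
    using z by (intro pos) (simp add: add_nonneg_pos)
  ultimately show ?thesis by (simp add: LIMSEQ_const_iff)
qed

section \<open>Functions with powers close to 1\<close>

text \<open>At a single point the powers could be near 1 because the value is a root of unity.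
  Continuity from \<open>r 0 = 1\<close> excludes this: n times the logarithm stays in a fixed strip
  for arbitrarily large n, so its imaginary part is 0; the modulus then handles the real
  part.\<close>

lemma eq_1_if_powers_near_1:
  fixes r :: "real \<Rightarrow> complex"
  assumes cont: "continuous_on {-d..d} r" and "r 0 = 1" and Re: "\<And>t. t \<in> {-d..d} \<Longrightarrow> 0 < Re (r t)"
    and inf: "infinite N"
    and near: "\<And>n t. n \<in> N \<Longrightarrow> t \<in> {-d..d} \<Longrightarrow> norm (r t ^ n - 1) \<le> 1/2"
    and t: "t \<in> {-d..d}"
  shows "r t = 1"
proof -
  define L where "L s = Ln (r s)" for s
  have ne: "r s \<noteq> 0" if "s \<in> {-d..d}" for s
    using Re[OF that] by auto
  \<comment> \<open>Positive real part keeps \<open>r\<close> off the branch cut of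
    \<open>Ln\<close>.\<close>
  have contL: "continuous_on {-d..d} L"
    unfolding L_def using Re by (intro continuous_on_Ln' cont) (force simp: complex_nonpos_Reals_iff)
  have pow: "r s ^ n = exp (of_nat n * L s)" if "s \<in> {-d..d}" for s n
    using ne[OF that] by (simp add: L_def exp_of_nat_mult)
  have Im: "\<bar>real n * Im (L t)\<bar> < pi / 2" if n: "n \<in> N" for n
  proof -
    \<comment> \<open>The n-th power has real part at least 1/2, and its sign is that of this
      cosine.\<close>
    have cos: "0 < cos (real n * Im (L s))" if s: "s \<in> {-d..d}" for s
    proof -
      have "\<bar>Re (r s ^ n) - 1\<bar> \<le> 1/2"
        using near[OF n s] abs_Re_le_cmod[of "r s ^ n - 1"] by simp
      then have "0 < exp (Re (of_nat n * L s)) * cos (Im (of_nat n * L s))"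
        unfolding pow[OF s] Re_exp by linarith
      then show ?thesis by (simp add: zero_less_mult_iff)
    qed
    \<comment> \<open>A connected set of reals containing 0 and avoiding both \<plusminus>pi/2,
      where the cosine vanishes, lies between them.\<close>
    define T where "T = (\<lambda>s. real n * Im (L s)) ` {-d..d}"
    have conn: "connected T"
      unfolding T_def by (intro connected_continuous_image continuous_intros contL) simp
    have "0 \<in> T"
      using t \<open>r 0 = 1\<close> by (auto simp: T_def L_def intro!: image_eqI[where x = 0])
    moreover have "real n * Im (L t) \<in> T" using t by (auto simp: T_def)
    moreover have "0 < cos y" if "y \<in> T" for y
      using that cos by (auto simp: T_def)
    from this[of "pi / 2"] this[of "- (pi / 2)"]
    have "pi / 2 \<notin> T" "- (pi / 2) \<notin> T" by auto
    ultimately have "\<not> pi / 2 \<le> real n * Im (L t)" "\<not> real n * Im (L t) \<le> - (pi / 2)"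
      using connectedD_interval[OF conn, of 0 "real n * Im (L t)" "pi / 2"]
        connectedD_interval[OF conn, of "real n * Im (L t)" 0 "- (pi / 2)"] by auto
    then show ?thesis by linarith
  qed
  have large: "\<exists>n\<in>N. y < real n" for y :: real
    using inf by (metis infinite_nat_iff_unbounded order.strict_trans reals_Archimedean2 of_nat_less_iff)
  have Im0: "Im (L t) = 0"
  proof (rule ccontr)
    assume "Im (L t) \<noteq> 0"
    obtain n where "n \<in> N" "pi / 2 / \<bar>Im (L t)\<bar> < real n" using large by blast
    then show False
      using Im[of n] \<open>Im (L t) \<noteq> 0\<close> by (simp add: abs_mult field_simps)
  qed
  have "Re (L t) = 0"
  proof (rule ccontr)
    assume R: "Re (L t) \<noteq> 0"
    \<comment> \<open>Once |n Re L| > 1, the modulus of the n-th power is at least 2 or below 1/2,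
      hence not within 1/2 of 1.\<close>
    obtain n where n: "n \<in> N" "1 / \<bar>Re (L t)\<bar> < real n" using large by blast
    then have big: "1 < \<bar>real n * Re (L t)\<bar>"
      using R by (simp add: abs_mult field_simps)
    have "\<bar>exp (real n * Re (L t)) - 1\<bar> \<le> 1/2"
      using near[OF n(1) t] abs_Re_le_cmod[of "r t ^ n - 1"] Im0 by (simp add: pow[OF t] Re_exp)
    then show False
    proof (cases "0 < real n * Re (L t)")
      case True
      then have "2 \<le> exp (real n * Re (L t))"
        using big exp_ge_add_one_self[of "real n * Re (L t)"] by linarith
      then show False using \<open>\<bar>exp (real n * Re (L t)) - 1\<bar> \<le> 1/2\<close> by linarith
    next
      case False
      then have "2 < exp (- (real n * Re (L t)))"
        using big exp_ge_add_one_self[of "- (real n * Re (L t))"] exp_gt_one by linarith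
      moreover have "1/2 \<le> exp (real n * Re (L t))"
        using \<open>\<bar>exp (real n * Re (L t)) - 1\<bar> \<le> 1/2\<close> by linarith
      ultimately have "1/2 * 2 < exp (real n * Re (L t)) * exp (- (real n * Re (L t)))"
        by (intro mult_le_less_imp_less) auto
      then show False by (simp flip: exp_add)
    qed
  qed
  then have "L t = 0" using Im0 by (simp add: complex_eq_iff)
  then show ?thesis using pow[OF t, of 1] by simp
qed

section \<open>Consequences of agreement on the nonnegative half-line\<close>

lemma agree_nonneg_measure_neg:
  assumes "real_distribution M" "real_distribution N" "agree_nonneg M N" "1 \<le> n"
  shows "measure (conv_pow M n) {..<0} = measure (conv_pow N n) {..<0}"
  using assms by (simp add: measure_neg_eq real_distribution_conv_pow agree_nonneg_def)

text \<open>(E) sees the convolution powers only through their mass on the negative half-line, the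
  complement of a mass on which they agree.\<close>

lemma agree_nonneg_cond_E_iff:
  assumes "real_distribution M" "real_distribution N" "agree_nonneg M N"
  shows "cond_E M \<longleftrightarrow> cond_E N"
proof -
  have "{n. n \<ge> 1 \<and> measure (conv_pow M n) {..<0} \<le> exp (- \<alpha> * real n)} =
      {n. n \<ge> 1 \<and> measure (conv_pow N n) {..<0} \<le> exp (- \<alpha> * real n)}" for \<alpha>
    using agree_nonneg_measure_neg[OF assms] by auto
  then show ?thesis by (simp add: cond_E_def)
qed

text \<open>The powers are characteristic functions of convolution powers, so only integrals of a
  unimodular function over the negative half-line survive in the difference.\<close>

lemma agree_nonneg_char_power_diff_le:
  assumes M: "real_distribution M" and N: "real_distribution N" and "agree_nonneg M N" "1 \<le> n"
  shows "norm (char M t ^ n - char N t ^ n) \<le> 2 * measure (conv_pow N n) {..<0}"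
proof -
  note Mn = real_distribution_conv_pow[OF M, of n] and Nn = real_distribution_conv_pow[OF N, of n]
  let ?I = "\<lambda>P. \<integral>x. indicator {..<0} x *\<^sub>R iexp (t * x) \<partial>P"
  have "char M t ^ n - char N t ^ n = char (conv_pow M n) t - char (conv_pow N n) t"
    by (simp add: char_conv_pow M N)
  also have "\<dots> = ?I (conv_pow M n) - ?I (conv_pow N n)"
    unfolding char_def
    by (rule integral_diff_eq_neg_part[OF Mn Nn, where B = 1])
      (use assms in \<open>auto simp: agree_nonneg_def\<close>)
  also have "norm \<dots> \<le> norm (?I (conv_pow M n)) + norm (?I (conv_pow N n))"
    by (rule norm_triangle_ineq4)
  also have "\<dots> \<le> measure (conv_pow M n) {..<0} + measure (conv_pow N n) {..<0}"
    by (intro add_mono norm_integral_neg_part_le Mn Nn) auto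
  finally show ?thesis
    using agree_nonneg_measure_neg[OF assms] by simp
qed

text \<open>Near 0 the modulus of \<open>char N\<close> exceeds exp(-\<alpha>/2), so its n-th power
  dominates the error of order exp(-\<alpha> n) and the quotient has powers near 1.\<close>

lemma cond_E_char_eq_near_0:
  assumes M: "real_distribution M" and N: "real_distribution N" and agr: "agree_nonneg M N"
    and "cond_E N"
  shows "\<exists>d>0. \<forall>t. \<bar>t\<bar> < d \<longrightarrow> char M t = char N t"
proof -
  interpret M: real_distribution M by fact
  interpret N: real_distribution N by fact
  obtain \<alpha> where \<alpha>: "\<alpha> > 0"
    and inf: "infinite {n. n \<ge> 1 \<and> measure (conv_pow N n) {..<0} \<le> exp (- \<alpha> * real n)}"
    using \<open>cond_E N\<close> by (auto simp: cond_E_def)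
  \<comment> \<open>From n \<ge> 6/\<alpha> follows exp(\<alpha> n/2) \<ge> 1 + 3 = 4, which turns
    the factor 2 exp(-\<alpha> n/2) into at most 1/2.\<close>
  define n0 where "n0 = nat \<lceil>6 / \<alpha>\<rceil>"
  define A where "A = {n. n \<ge> 1 \<and> measure (conv_pow N n) {..<0} \<le> exp (- \<alpha> * real n)} - {..<n0}"
  have "infinite A" unfolding A_def using inf by (intro Diff_infinite_finite) auto
  define r where "r t = char M t / char N t" for t
  have r0: "r 0 = 1" by (simp add: r_def M.char_zero N.char_zero)
  have "isCont r 0"
    unfolding r_def using N.char_zero by (intro continuous_intros M.isCont_char N.isCont_char) auto
  \<comment> \<open>Passing to \<open>nhds\<close> makes the neighbourhoods below include 0
    itself.\<close>
  then have "(r \<longlongrightarrow> r 0) (nhds 0)"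
    by (simp only: isCont_def tendsto_at_iff_tendsto_nhds)
  then have "((\<lambda>t. Re (r t)) \<longlongrightarrow> 1) (nhds 0)"
    using tendsto_Re[of r "r 0" "nhds 0"] r0 by simp
  then have ev1: "\<forall>\<^sub>F t in nhds 0. 0 < Re (r t)"
    by (rule order_tendstoD) simp
  have "((\<lambda>t. norm (char N t)) \<longlongrightarrow> norm (char N 0)) (nhds 0)"
    using N.isCont_char[of 0] by (auto simp: isCont_def tendsto_at_iff_tendsto_nhds intro!: tendsto_intros)
  then have ev2: "\<forall>\<^sub>F t in nhds 0. exp (- \<alpha> / 2) < norm (char N t)"
    by (rule order_tendstoD) (use \<alpha> in \<open>simp add: N.char_zero\<close>)
  obtain e where e: "e > 0" "\<And>t. dist t 0 < e \<Longrightarrow> 0 < Re (r t) \<and> exp (- \<alpha> / 2) < norm (char N t)"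
    using eventually_conj[OF ev1 ev2] unfolding eventually_nhds_metric by blast
  \<comment> \<open>Halving puts the closed interval inside the open one.\<close>
  define d where "d = e / 2"
  have d: "d > 0" "\<And>t. t \<in> {-d..d} \<Longrightarrow> 0 < Re (r t)"
    "\<And>t. t \<in> {-d..d} \<Longrightarrow> exp (- \<alpha> / 2) < norm (char N t)"
    using e by (auto simp: d_def dist_real_def)
  have ne: "char N t \<noteq> 0" if "t \<in> {-d..d}" for t
    using d(3)[OF that] by (smt (verit) exp_gt_zero norm_zero)
  have near: "norm (r t ^ n - 1) \<le> 1/2" if n: "n \<in> A" and t: "t \<in> {-d..d}" for n t
  proof -
    have "n0 \<le> n" using n by (simp add: A_def)
    then have "6 / \<alpha> \<le> real n"
      using real_nat_ceiling_ge[of "6 / \<alpha>"] unfolding n0_def by linarith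
    then have n3: "3 \<le> \<alpha> / 2 * real n" using \<alpha> by (simp add: field_simps)
    have low: "exp (- \<alpha> / 2 * real n) \<le> norm (char N t) ^ n"
      using power_mono[OF less_imp_le[OF d(3)[OF t]], of n]
      by (simp flip: exp_of_nat_mult add: mult.commute)
    have "norm (char M t ^ n - char N t ^ n) \<le> 2 * measure (conv_pow N n) {..<0}"
      using n by (intro agree_nonneg_char_power_diff_le M N agr) (auto simp: A_def)
    also have "\<dots> \<le> 2 * exp (- \<alpha> * real n)"
      using n by (simp add: A_def)
    \<comment> \<open>One half of the exponent is absorbed by the power of \<open>char N\<close>,
      the other supplies the smallness.\<close>
    also have "\<dots> = 2 * exp (- (\<alpha> / 2 * real n)) * exp (- \<alpha> / 2 * real n)"
      by (simp flip: exp_add)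
    also have "\<dots> \<le> 1/2 * norm (char N t) ^ n"
    proof (rule mult_mono[OF _ low])
      have "4 \<le> exp (\<alpha> / 2 * real n)"
        using n3 exp_ge_add_one_self[of "\<alpha> / 2 * real n"] by linarith
      then show "2 * exp (- (\<alpha> / 2 * real n)) \<le> 1/2"
        by (simp add: exp_minus field_simps)
    qed auto
    finally have "norm (char M t ^ n - char N t ^ n) \<le> 1/2 * norm (char N t ^ n)"
      by (simp add: norm_power)
    then have "norm ((char M t ^ n - char N t ^ n) / char N t ^ n) \<le> 1/2"
      using ne[OF t] by (simp add: norm_divide field_simps)
    also have "(char M t ^ n - char N t ^ n) / char N t ^ n = r t ^ n - 1"
      using ne[OF t] by (simp add: r_def power_divide diff_divide_distrib)
    finally show ?thesis .
  qed
  have contr: "continuous_on {-d..d} r"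
    unfolding r_def using ne
    by (intro continuous_on_divide continuous_at_imp_continuous_on ballI M.isCont_char N.isCont_char) auto
  have "char M t = char N t" if "\<bar>t\<bar> < d" for t
  proof -
    have t: "t \<in> {-d..d}" using that by auto
    have "r t = 1"
      by (rule eq_1_if_powers_near_1[OF contr r0 d(2) \<open>infinite A\<close> near t])
    then show ?thesis using ne[OF t] by (simp add: r_def)
  qed
  then show ?thesis using d(1) by blast
qed

text \<open>Local equality of characteristic functions does not determine a measure in general; here
  the one-sided support of the difference makes it propagate to the whole line.\<close>

lemma agree_nonneg_cond_E_imp_eq:
  assumes M: "real_distribution M" and N: "real_distribution N" and agr: "agree_nonneg M N"
    and "cond_E N"
  shows "M = N"
proof (rule Levy_uniqueness[OF M N], rule ext)
  fix t
  obtain d where d: "d > 0" "\<And>t. \<bar>t\<bar> < d \<Longrightarrow> char M t = char N t"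
    using cond_E_char_eq_near_0[OF assms] by blast
  define f where "f z = laplace_neg M z - laplace_neg N z" for z
  have f_axis: "f (\<i> * of_real s) = char M s - char N s" for s
  proof -
    have "measure M A = measure N A" if "A \<in> sets borel" "A \<subseteq> {0..}" for A
      using agr that conv_pow_1[OF M] conv_pow_1[OF N] unfolding agree_nonneg_def
      by (metis order_refl)
    then have "char M s - char N s = laplace_neg M (\<i> * of_real s) - laplace_neg N (\<i> * of_real s)"
      unfolding char_def laplace_neg_def
      by (subst integral_diff_eq_neg_part[OF M N, where B = 1]) (auto simp: mult.assoc)
    then show ?thesis by (simp add: f_def)
  qed
  have "f (\<i> * of_real t) = 0"
  \<comment> \<open>Applied at a boundary point: \<open>t\<close> is arbitrary, not restricted to
    the interval of radius \<open>d\<close>.\<close>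
  proof (rule half_plane_uniqueness[where f = f, OF _ _ d(1)])
    show "f holomorphic_on {z. 0 < Re z}"
      unfolding f_def by (intro holomorphic_intros holomorphic_on_laplace_neg M N)
    show "continuous_on {z. 0 \<le> Re z} f"
      unfolding f_def by (intro continuous_intros continuous_on_laplace_neg M N)
  qed (use d(2) f_axis in auto)
  then show "char M t = char N t" by (simp add: f_axis)
qed

theorem theorem2p4:
  fixes \<mu> :: "real measure"
  assumes "real_prob \<mu>"
    and "\<not> msupport \<mu> \<subseteq> {..<0}"
  shows "(\<forall>\<mu>1. real_prob \<mu>1 \<and> agree_nonneg \<mu>1 \<mu> \<longrightarrow> (cond_E \<mu>1 \<longleftrightarrow> cond_E \<mu>)) \<and>
         (cond_E \<mu> \<longrightarrow> classC \<mu>)"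
  using assms(1) agree_nonneg_cond_E_iff agree_nonneg_cond_E_imp_eq
  unfolding classC_def real_prob_iff_real_distribution by blast

end
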